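(* The schemata DP and HE are independent of each other in minimal logic with LEM. That is, some instance of HE is not derivable in minimal first-order logic extended by all instances of LEM and DP, and some instance of DP is not derivable in minimal first-order logic extended by all instances of LEM and HE. In particular they are independent over decidable predicates: there is a formula $Px$ such that $\mathrm{HE}(Px)$ is not derivable from the assumption $\forall x\,(Px\vee\lnot Px)$ in minimal logic extended by DP, and there is a formula $Px$ such that $\mathrm{DP}(Px)$ is not derivable from the assumption $\forall x\,(Px\vee\lnot Px)$ in minimal logic extended by HE.
   Context: Fix a first-order language (without equality) with countably many relation symbols of each arity. Minimal logic is first-order natural deduction with the introduction and elimination rules for $\to,\wedge,\vee,\forall,\exists$, in which $\bot$ is a propositional constant with no special rule, and $\lnot A := A\to\bot$. Schemata, for arbitrary formulas $A$, $Px$ (possibly with further free variables), with $Py$ denoting $Px$ with the fresh variable $y$ substituted for $x$: $\mathrm{LEM}(A):=A\vee\lnot A$, $\mathrm{DP}(Px) := \exists y\,(Py \to \forall x\, Px)$, $\mathrm{HE}(Px) := \exists y\,(\exists x\, Px \to Py)$. Extending a logic by a scheme means adding, for every formula instance of the scheme (possibly with free variables), a premise-free deduction rule concluding that instance; $\forall$-introduction may be applied to free variables of such instances. *)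

theory Defs
  imports Main
begin

text \<open>
  Formulas over a purely relational language, with de Bruijn indices as variables (the only terms).
  In \<open>Rel r ts\<close> the relation symbol is the pair of the name \<open>r\<close> and the arity \<open>length ts\<close>, so there
  are countably many relation symbols of every arity (including 0).
\<close>

datatype form =
    Bot
  | Rel nat "nat list"
  | Imp form form
  | And form form
  | Or form form
  | All form
  | Ex form

definition Neg :: "form \<Rightarrow> form" where
  "Neg A = Imp A Bot"

definition up :: "(nat \<Rightarrow> nat) \<Rightarrow> nat \<Rightarrow> nat" where
  "up f i = (case i of 0 \<Rightarrow> 0 | Suc j \<Rightarrow> Suc (f j))"

text \<open>Simultaneous capture-avoiding substitution of variables for free variables.\<close>

primrec ren :: "(nat \<Rightarrow> nat) \<Rightarrow> form \<Rightarrow> form" where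
  "ren f Bot = Bot"
| "ren f (Rel r ts) = Rel r (map f ts)"
| "ren f (Imp A B) = Imp (ren f A) (ren f B)"
| "ren f (And A B) = And (ren f A) (ren f B)"
| "ren f (Or A B) = Or (ren f A) (ren f B)"
| "ren f (All A) = All (ren (up f) A)"
| "ren f (Ex A) = Ex (ren (up f) A)"

text \<open>
  \<open>shift A\<close> is \<open>A\<close> read under one further binder, whose variable (index 0) is fresh for it.
  If the bound variable of \<open>A\<close> has index 0, then \<open>inst A t\<close> replaces it by the variable \<open>t\<close>.
\<close>

definition shift :: "form \<Rightarrow> form" where
  "shift A = ren Suc A"

definition inst :: "form \<Rightarrow> nat \<Rightarrow> form" where
  "inst A t = ren (\<lambda>i. case i of 0 \<Rightarrow> t | Suc j \<Rightarrow> j) A"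

text \<open>
  \<open>derivable S \<Gamma> A\<close>: \<open>A\<close> is derivable from the open assumptions \<open>\<Gamma>\<close> in minimal logic extended by the
  premise-free rules concluding the members of \<open>S\<close>.  The eigenvariable conditions of \<open>AllI\<close> and \<open>ExE\<close>
  are expressed by shifting the assumptions and the conclusion; since members of \<open>S\<close> are not
  assumptions, their free variables may be generalised.
\<close>

inductive derivable :: "form set \<Rightarrow> form list \<Rightarrow> form \<Rightarrow> bool" for S :: "form set" where
  Assm: "A \<in> set \<Gamma> \<Longrightarrow> derivable S \<Gamma> A"
| Scheme: "A \<in> S \<Longrightarrow> derivable S \<Gamma> A"
| ImpI: "derivable S (A # \<Gamma>) B \<Longrightarrow> derivable S \<Gamma> (Imp A B)"
| ImpE: "derivable S \<Gamma> (Imp A B) \<Longrightarrow> derivable S \<Gamma> A \<Longrightarrow> derivable S \<Gamma> B"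
| AndI: "derivable S \<Gamma> A \<Longrightarrow> derivable S \<Gamma> B \<Longrightarrow> derivable S \<Gamma> (And A B)"
| AndE1: "derivable S \<Gamma> (And A B) \<Longrightarrow> derivable S \<Gamma> A"
| AndE2: "derivable S \<Gamma> (And A B) \<Longrightarrow> derivable S \<Gamma> B"
| OrI1: "derivable S \<Gamma> A \<Longrightarrow> derivable S \<Gamma> (Or A B)"
| OrI2: "derivable S \<Gamma> B \<Longrightarrow> derivable S \<Gamma> (Or A B)"
| OrE: "derivable S \<Gamma> (Or A B) \<Longrightarrow> derivable S (A # \<Gamma>) C \<Longrightarrow> derivable S (B # \<Gamma>) C
    \<Longrightarrow> derivable S \<Gamma> C"
| AllI: "derivable S (map shift \<Gamma>) A \<Longrightarrow> derivable S \<Gamma> (All A)"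
| AllE: "derivable S \<Gamma> (All A) \<Longrightarrow> derivable S \<Gamma> (inst A t)"
| ExI: "derivable S \<Gamma> (inst A t) \<Longrightarrow> derivable S \<Gamma> (Ex A)"
| ExE: "derivable S \<Gamma> (Ex A) \<Longrightarrow> derivable S (A # map shift \<Gamma>) (shift C)
    \<Longrightarrow> derivable S \<Gamma> C"

text \<open>
  In \<open>DP P\<close>, \<open>HE P\<close> and \<open>decidable P\<close> the variable \<open>x\<close> of \<open>Px\<close> is index 0 of \<open>P\<close>; the indices
  above 0 are the further free variables.  Directly under the binder of \<open>y\<close>, the formula \<open>P\<close>
  itself is \<open>Py\<close>.
\<close>

definition LEM :: "form \<Rightarrow> form" where
  "LEM A = Or A (Neg A)"

definition DP :: "form \<Rightarrow> form" where
  "DP P = Ex (Imp P (shift (All P)))"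

definition HE :: "form \<Rightarrow> form" where
  "HE P = Ex (Imp (shift (Ex P)) P)"

definition decidable :: "form \<Rightarrow> form" where
  "decidable P = All (Or P (Neg P))"

end

theory Submission imports Defs "HOL-Library.Extended_Nat" begin

text \<open>
  In minimal logic \<open>\<bottom>\<close> may be read as any proposition, in particular as a true one.  Then every
  negation is true, so that \<open>LEM\<close> and decidability hold for trivial reasons, and what remains is to
  separate \<open>DP\<close> from \<open>HE\<close> in positive intuitionistic logic.  This is done with Kripke models with
  the constant domain \<open>nat\<close>.

  In such a model the truth set of a formula is a set of worlds that is closed under accessibility.
  \<open>DP\<close> holds if, among the truth sets of the instances of \<open>P\<close>, there is always a least one: its
  instance is the drinker.  Dually, \<open>HE\<close> holds if there is always a greatest one.  Let the worlds be
  well-ordered.  If accessibility is \<open>\<le>\<close>, an instance that is true at the least world where any is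
  true has the greatest truth set; if it is \<open>\<ge>\<close>, an instance that is false at the least world where
  any is false has the least one.  (Without such a world, every instance will do.)  Thus well-ordered
  frames validate \<open>HE\<close> and reversed well-ordered frames validate \<open>DP\<close>, whatever the formula and the
  values of its parameters (lemmas \<open>HE_on_wellorder\<close> and \<open>DP_on_reversed_wellorder\<close>).

  Each kind of frame refutes the other scheme.  On \<open>nat\<close> with \<open>\<le>\<close>, let \<open>P n\<close> become true at world
  \<open>n\<close>: the truth sets shrink to the empty set, which none of them attains, so \<open>DP\<close> fails.  On
  \<open>\<omega> + 1\<close> with \<open>\<ge>\<close>, let \<open>P n\<close> be true at the worlds up to \<open>n\<close>: the truth sets grow to the set of
  all finite worlds, which none of them attains, so \<open>HE\<close> fails at the world \<open>\<omega>\<close>.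
\<close>

section \<open>Kripke models with constant domain and true absurdity\<close>

locale kripke_model =
  fixes acc :: "'w \<Rightarrow> 'w \<Rightarrow> bool"
    and rel :: "nat \<Rightarrow> nat list \<Rightarrow> 'w \<Rightarrow> bool"
  assumes acc_refl: "acc w w"
    and acc_trans: "acc u v \<Longrightarrow> acc v w \<Longrightarrow> acc u w"
    and rel_mono: "rel r ds v \<Longrightarrow> acc v w \<Longrightarrow> rel r ds w"
begin

primrec forces :: "(nat \<Rightarrow> nat) \<Rightarrow> 'w \<Rightarrow> form \<Rightarrow> bool" where
  "forces \<rho> w Bot = True"
| "forces \<rho> w (Rel r ts) = rel r (map \<rho> ts) w"
| "forces \<rho> w (Imp A B) = (\<forall>v. acc w v \<longrightarrow> forces \<rho> v A \<longrightarrow> forces \<rho> v B)"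
| "forces \<rho> w (And A B) = (forces \<rho> w A \<and> forces \<rho> w B)"
| "forces \<rho> w (Or A B) = (forces \<rho> w A \<or> forces \<rho> w B)"
| "forces \<rho> w (All A) = (\<forall>d. forces (case_nat d \<rho>) w A)"
| "forces \<rho> w (Ex A) = (\<exists>d. forces (case_nat d \<rho>) w A)"

definition valid :: "form \<Rightarrow> bool" where
  "valid A \<longleftrightarrow> (\<forall>\<rho> w. forces \<rho> w A)"

lemma forces_mono: "forces \<rho> v A \<Longrightarrow> acc v w \<Longrightarrow> forces \<rho> w A"
proof (induction A arbitrary: \<rho>)
  case (Rel r ts)
  then show ?case by (simp add: rel_mono)
next
  case (Imp A B)
  then show ?case by (auto intro: acc_trans)
qed auto

lemma forces_ren: "forces \<rho> w (ren f A) \<longleftrightarrow> forces (\<lambda>i. \<rho> (f i)) w A"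
proof (induction A arbitrary: \<rho> w f)
  case (Rel r ts)
  then show ?case by (simp add: comp_def)
next
  have up: "(\<lambda>i. case_nat d \<rho> (up f i)) = case_nat d (\<lambda>i. \<rho> (f i))" for d :: nat and \<rho> f
    by (auto simp: fun_eq_iff up_def split: nat.split)
  {
    case (All A)
    then show ?case by (simp add: up)
  next
    case (Ex A)
    then show ?case by (simp add: up)
  }
qed auto

lemma forces_shift [simp]: "forces (case_nat d \<rho>) w (shift A) \<longleftrightarrow> forces \<rho> w A"
  by (simp add: shift_def forces_ren)

lemma forces_inst: "forces \<rho> w (inst A t) \<longleftrightarrow> forces (case_nat (\<rho> t) \<rho>) w A"
proof -
  have "(\<lambda>i. \<rho> (case i of 0 \<Rightarrow> t | Suc j \<Rightarrow> j)) = case_nat (\<rho> t) \<rho>"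
    by (auto simp: fun_eq_iff split: nat.split)
  then show ?thesis by (simp add: inst_def forces_ren)
qed

text \<open>
  The members of \<open>S\<close> have to be forced under every assignment, since their free variables may be
  generalised inside a derivation.
\<close>

lemma soundness:
  assumes "derivable S \<Gamma> A" and S: "\<forall>B\<in>S. valid B" and "\<forall>B\<in>set \<Gamma>. forces \<rho> w B"
  shows "forces \<rho> w A"
  using assms(1,3)
proof (induction arbitrary: \<rho> w)
  case (Scheme A \<Gamma>)
  then show ?case using S by (simp add: valid_def)
next
  case (ImpI A \<Gamma> B)
  have "forces \<rho> v B" if "acc w v" and "forces \<rho> v A" for v
    using ImpI.prems that by (intro ImpI.IH) (auto intro: forces_mono)
  then show ?case by simp
next
  case (ImpE \<Gamma> A B)
  then show ?case using acc_refl by fastforce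
next
  case (OrE \<Gamma> A B C)
  then show ?case by fastforce
next
  case (AllE \<Gamma> A t)
  then show ?case by (simp add: forces_inst)
next
  case (ExI \<Gamma> A t)
  then show ?case by (auto simp: forces_inst)
next
  case (ExE \<Gamma> A C)
  then obtain d where "forces (case_nat d \<rho>) w A" by fastforce
  with ExE.prems have "forces (case_nat d \<rho>) w (shift C)"
    by (intro ExE.IH) auto
  then show ?case by simp
qed auto

lemma LEM_valid: "valid (LEM A)"
  by (simp add: valid_def LEM_def Neg_def)

lemma decidable_valid: "valid (decidable A)"
  by (simp add: valid_def decidable_def Neg_def)

lemma not_derivable:
  assumes "\<forall>B\<in>S. valid B" and "\<forall>B\<in>set \<Gamma>. valid B" and "\<not> valid A"
  shows "\<not> derivable S \<Gamma> A"
  using soundness[of S \<Gamma> A] assms unfolding valid_def by blast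

section \<open>The two schemes as extremality conditions on truth sets\<close>

lemma forces_DP:
  "forces \<rho> w (DP P) \<longleftrightarrow>
    (\<exists>d. \<forall>v. acc w v \<longrightarrow> forces (case_nat d \<rho>) v P \<longrightarrow> (\<forall>e. forces (case_nat e \<rho>) v P))"
  by (simp add: DP_def)

lemma forces_HE:
  "forces \<rho> w (HE P) \<longleftrightarrow>
    (\<exists>d. \<forall>v. acc w v \<longrightarrow> (\<exists>e. forces (case_nat e \<rho>) v P) \<longrightarrow> forces (case_nat d \<rho>) v P)"
  by (simp add: HE_def)

end

text \<open>
  If some instance of \<open>P\<close> fails somewhere, choose one that fails at the least possible world.  Its
  truth set consists of the worlds below that one, and there every instance holds.
\<close>

lemma DP_on_reversed_wellorder:
  fixes rel :: "nat \<Rightarrow> nat list \<Rightarrow> 'w::wellorder \<Rightarrow> bool"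
  assumes "kripke_model (\<ge>) rel"
  shows "kripke_model.valid (\<ge>) rel (DP P)"
proof -
  interpret kripke_model "(\<ge>)" rel by fact
  have "forces \<rho> w (DP P)" for \<rho> w
  proof -
    define fails where "fails v \<longleftrightarrow> (\<exists>d. \<not> forces (case_nat d \<rho>) v P)" for v
    show ?thesis
    proof (cases "\<exists>v. fails v")
      case True
      define m where "m = (LEAST v. fails v)"
      from True have "fails m" unfolding m_def by (rule LeastI_ex)
      then obtain d where d: "\<not> forces (case_nat d \<rho>) m P" by (auto simp: fails_def)
      have "\<forall>e. forces (case_nat e \<rho>) v P" if "forces (case_nat d \<rho>) v P" for v
      proof -
        from d that have "v < m" using forces_mono not_le by blast
        then have "\<not> fails v" unfolding m_def by (rule not_less_Least)
        then show ?thesis by (simp add: fails_def)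
      qed
      then show ?thesis by (auto simp: forces_DP)
    next
      case False
      then show ?thesis by (auto simp: forces_DP fails_def)
    qed
  qed
  then show ?thesis by (simp add: valid_def)
qed

text \<open>
  If some instance of \<open>P\<close> holds somewhere, choose one that holds at the least possible world.  Its
  truth set consists of the worlds from that one on, and no instance holds at any other world.
\<close>

lemma HE_on_wellorder:
  fixes rel :: "nat \<Rightarrow> nat list \<Rightarrow> 'w::wellorder \<Rightarrow> bool"
  assumes "kripke_model (\<le>) rel"
  shows "kripke_model.valid (\<le>) rel (HE P)"
proof -
  interpret kripke_model "(\<le>)" rel by fact
  have "forces \<rho> w (HE P)" for \<rho> w
  proof -
    define holds where "holds v \<longleftrightarrow> (\<exists>d. forces (case_nat d \<rho>) v P)" for v
    show ?thesis
    proof (cases "\<exists>v. holds v")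
      case True
      define m where "m = (LEAST v. holds v)"
      from True have "holds m" unfolding m_def by (rule LeastI_ex)
      then obtain d where d: "forces (case_nat d \<rho>) m P" by (auto simp: holds_def)
      have "forces (case_nat d \<rho>) v P" if "holds v" for v
      proof -
        from that have "m \<le> v" unfolding m_def by (rule Least_le)
        with d show ?thesis by (rule forces_mono)
      qed
      then show ?thesis by (auto simp: forces_HE holds_def)
    next
      case False
      then show ?thesis by (auto simp: forces_HE holds_def)
    qed
  qed
  then show ?thesis by (simp add: valid_def)
qed

section \<open>The two countermodels\<close>

text \<open>
  The world \<open>\<infinity>\<close> is needed as a root: a finite world \<open>v\<close> still forces \<open>HE P\<close>, with \<open>v\<close>
  itself as the witness, because \<open>P v\<close> is true at every world accessible from it.
\<close>

lemma HE_independent_of_LEM_DP: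
  fixes P :: form
  defines "P \<equiv> Rel 0 [0]"
  shows "\<not> derivable (range LEM \<union> range DP) [] (HE P)"
    and "\<not> derivable (range DP) [decidable P] (HE P)"
proof -
  define rel where "rel r ds w \<longleftrightarrow> w \<le> enat (hd ds)" for r :: nat and ds w
  have model: "kripke_model (\<ge>) rel"
    by unfold_locales (auto simp: rel_def)
  then interpret kripke_model "(\<ge>)" rel .
  have DP: "valid (DP A)" for A using model by (rule DP_on_reversed_wellorder)
  have "\<not> forces \<rho> \<infinity> (HE P)" for \<rho>
  proof
    assume "forces \<rho> \<infinity> (HE P)"
    then obtain d where d: "(\<exists>e. v \<le> enat e) \<longrightarrow> v \<le> enat d" for v
      by (auto simp: forces_HE P_def rel_def)
    from d[of "enat (Suc d)"] show False by auto
  qed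
  then have HE: "\<not> valid (HE P)" by (auto simp: valid_def)
  show "\<not> derivable (range LEM \<union> range DP) [] (HE P)"
    using LEM_valid DP HE by (intro not_derivable) auto
  show "\<not> derivable (range DP) [decidable P] (HE P)"
    using decidable_valid DP HE by (intro not_derivable) auto
qed

lemma DP_independent_of_LEM_HE:
  fixes P :: form
  defines "P \<equiv> Rel 0 [0]"
  shows "\<not> derivable (range LEM \<union> range HE) [] (DP P)"
    and "\<not> derivable (range HE) [decidable P] (DP P)"
proof -
  define rel where "rel r ds w \<longleftrightarrow> hd ds \<le> w" for r :: nat and ds :: "nat list" and w
  have model: "kripke_model (\<le>) rel"
    by unfold_locales (auto simp: rel_def)
  then interpret kripke_model "(\<le>)" rel .
  have HE: "valid (HE A)" for A using model by (rule HE_on_wellorder)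
  have "\<not> forces \<rho> 0 (DP P)" for \<rho>
  proof
    assume "forces \<rho> 0 (DP P)"
    then obtain d :: nat where "\<forall>v\<ge>d. \<forall>e. e \<le> v"
      by (auto simp: forces_DP P_def rel_def)
    then have "Suc d \<le> d" by blast
    then show False by simp
  qed
  then have DP: "\<not> valid (DP P)" by (auto simp: valid_def)
  show "\<not> derivable (range LEM \<union> range HE) [] (DP P)"
    using LEM_valid HE DP by (intro not_derivable) auto
  show "\<not> derivable (range HE) [decidable P] (DP P)"
    using decidable_valid HE DP by (intro not_derivable) auto
qed

theorem corollary7:
  shows "(\<exists>P. \<not> derivable (range LEM \<union> range DP) [] (HE P))
    \<and> (\<exists>P. \<not> derivable (range LEM \<union> range HE) [] (DP P))
    \<and> (\<exists>P. \<not> derivable (range DP) [decidable P] (HE P))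
    \<and> (\<exists>P. \<not> derivable (range HE) [decidable P] (DP P))"
  using HE_independent_of_LEM_DP DP_independent_of_LEM_HE by blast

end
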